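(* Let $\mathcal{G}:X\to Y$ be one of the two forward maps described in the context: either $\mathcal{G}=\mathcal{G}_{\mathrm{EIT}}$ with $Y=\mathbb{R}^{L\times L}$ and $\|\cdot\|_*$ the Frobenius norm, or $\mathcal{G}=\mathcal{G}_{\mathrm{QPAT}}$ with $Y=\mathbb{R}^{N_d}$ and $\|\cdot\|_*$ the $\ell^2$ (Euclidean) norm. Let $\mu_0$ be a (prior) probability measure on $X$, and let the noise $\eta$ in the model $y=\mathcal{G}(w)+\eta$ have i.i.d. centered Gaussian entries. Fix $y\in Y$. Let $\mu^y$ be the true posterior measure, obtained using $\mathcal{G}$. For each $\epsilon>0$ let $\mathcal{G}_\theta=\mathcal{G}_{\theta(\epsilon)}=\mathcal{A}\circ\mathcal{E}$, with $\mathcal{E}:X\to\mathbb{R}^P$ and $\mathcal{A}:\mathbb{R}^P\to Y$ continuous ($P=P(\epsilon)\in\mathbb{N}$), be a surrogate satisfying $$\left(\int_X\|\mathcal{G}(w)-\mathcal{G}_\theta(w)\|_*^2\,d\mu_0(w)\right)^{1/2}\le\epsilon ,$$ and let $\mu^y_\theta$ be the surrogate posterior measure, obtained using $\mathcal{G}_\theta$ in place of $\mathcal{G}$. Then $$|\mu^y-\mu^y_\theta|_{\mathrm{Hell}}\to0\qquad\text{as }\epsilon\to0,$$ where $|\cdot|_{\mathrm{Hell}}$ denotes the Hellinger distance.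
   Context: Probability measures on $X$ are Borel. **Posteriors and Hellinger distance.** Let the entries of $\eta$ be i.i.d. $N(0,\varsigma^2)$ with $\varsigma>0$ and independent of $w\sim\mu_0$. Define the potentials $$\mathit{\Phi}(w;y)=\frac{1}{2\varsigma^2}\|y-\mathcal{G}(w)\|_*^2,\qquad \mathit{\Phi}_\theta(w;y)=\frac{1}{2\varsigma^2}\|y-\mathcal{G}_\theta(w)\|_*^2,$$ and $Z_y=\int_X e^{-\mathit{\Phi}(w;y)}d\mu_0(w)$, $Z_y^\theta=\int_X e^{-\mathit{\Phi}_\theta(w;y)}d\mu_0(w)$. The posteriors are given by $$\frac{d\mu^y}{d\mu_0}(w)=\frac{1}{Z_y}e^{-\mathit{\Phi}(w;y)},\qquad \frac{d\mu^y_\theta}{d\mu_0}(w)=\frac{1}{Z^\theta_y}e^{-\mathit{\Phi}_\theta(w;y)},$$ and the Hellinger distance by $$|\mu^y-\mu^y_\theta|_{\mathrm{Hell}}^2=\frac12\int_X\left(\sqrt{\frac{e^{-\mathit{\Phi}(w;y)}}{Z_y}}-\sqrt{\frac{e^{-\mathit{\Phi}_\theta(w;y)}}{Z_y^\theta}}\right)^2d\mu_0(w).$$ **EIT (electrical impedance tomography) forward map.** Let $\Omega\subset\mathbb{R}^d$, $d\ge2$, be a bounded domain with sufficiently regular boundary, carrying $L$ disjoint electrodes $e_1,\dots,e_L\subset\partial\Omega$ with positive contact impedances $z_1,\dots,z_L$. For a conductivity $\sigma\in L^\infty(\Omega)$ (positive, bounded, and bounded away from zero) and a current pattern $I=(I_l)_{l=1}^L\in\mathbb{R}^L$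 with $\sum_l I_l=0$, the complete electrode model determines the potential $u$ and the electrode voltages $U=(U_l)_{l=1}^L\in\mathbb{R}^L$ (normalized by $\sum_l U_l=0$) through $$-\nabla\cdot(\sigma\nabla u)=0\ \text{in }\Omega,\qquad \int_{e_l}\sigma\frac{\partial u}{\partial n}\,dS=I_l\ (1\le l\le L),$$ $$\sigma\frac{\partial u}{\partial n}=0\ \text{on }\partial\Omega\setminus\bigcup_l e_l,\qquad u+z_l\sigma\frac{\partial u}{\partial n}=U_l\ \text{on } e_l\ (1\le l\le L),$$ understood in the usual weak sense. Write $U=R(\sigma)I$, where $R(\sigma)$ is the resistivity matrix. Fix current patterns $I^{(1)},\dots,I^{(L)}$ and let $G(\sigma)\in\mathbb{R}^{L\times L}$ be the matrix whose columns are the voltage vectors $R(\sigma)I^{(j)}$, $1\le j\le L$. Let $X=H^s(\bar\Omega)$ be the Sobolev space with $s>1$, a separable Hilbert space. Fix $M\in\mathbb{N}$, known constants $\sigma_1,\dots,\sigma_M>0$, and thresholds $-\infty=c_0<c_1<\dots<c_M=+\infty$. The level-set map is $$H(w)=\sum_{i=1}^M\sigma_i\mathbb{I}(\Omega_i),\qquad \Omega_i=\{x\in\Omega: c_{i-1}\le w(x)<c_i\},$$ where $\mathbb{I}(S)$ is the characteristic function of $S$. Then $\mathcal{G}_{\mathrm{EIT}}:=G\circ H:X\to\mathbb{R}^{L\times L}$. **QPAT (quantitative photoacoustic tomography) forward map.** Let $\Omega\subset\mathbb{R}^2$ be a bounded domain with sufficiently regular boundary. For a constant $\Lambda>0$ let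 $L^2_\Lambda(\Omega)=\{f\in L^2(\Omega):\Lambda^{-1}\le f\le\Lambda\text{ a.e.}\}$. Fix $\rho\in L^2_{\Lambda_\rho}(\Omega)$ (for a constant $\Lambda_\rho>0$) and boundary data $g\in H^{1/2}(\partial\Omega)$. For $\gamma\in L^2_\Lambda(\Omega)$ let $u$ be the weak solution of $$-\nabla\cdot(\rho\nabla u)+\gamma u=0\ \text{in }\Omega,\qquad u=g\ \text{on }\partial\Omega,$$ and set $G(\gamma)=\gamma u\in L^2(\Omega)$. Let $(e_k)_{k\ge1}$ be an orthonormal basis of $L^2(\Omega)$ consisting of eigenfunctions of the Dirichlet Laplacian on $\Omega$, and fix $N_d\in\mathbb{N}$. Star-shaped parametrization: let $\mathbb{T}=\mathbb{R}/2\pi\mathbb{Z}$, $\nu(\vartheta)=(\cos\vartheta,\sin\vartheta)$, fix $N\ge1$, centers $x^{(1)},\dots,x^{(N)}\in\Omega$ and constants $\kappa_1,\dots,\kappa_{N+1}>0$. Let $X=H^\beta(\mathbb{T})^N$ with $\beta>3/2$ (so that its elements have continuously differentiable components), a separable Hilbert space. For $w=(\psi^{(1)},\dots,\psi^{(N)})\in X$ put $$A^{(i)}=\Omega\cap\bigl(x^{(i)}+\{s\exp(\psi^{(i)}(\vartheta))\nu(\vartheta):0\le s\le1,\ 0\le\vartheta\le2\pi\}\bigr),\quad 1\le i\le N,$$ $A^{(N+1)}=\Omega\setminus\bigcup_{i=1}^N A^{(i)}$, and $\Phi(w)=\sum_{i=1}^{N+1}\kappa_i\mathbb{I}_{A^{(i)}}$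 (for a single inclusion, $N=1$, one may equivalently write $\Phi(\psi)=\kappa_1'\mathbb{I}_{A}+\kappa_2'$ with $\kappa_1',\kappa_2'>0$). This parametrization $\Phi$ is distinct from the potential $\mathit{\Phi}(w;y)$. The constant $\Lambda$ is such that $\Phi$ maps $X$ into $L^2_\Lambda(\Omega)$. Then $\mathcal{G}_{\mathrm{QPAT}}:X\to\mathbb{R}^{N_d}$ is $$\mathcal{G}_{\mathrm{QPAT}}(w)=\bigl(\langle G(\Phi(w)),e_k\rangle_{L^2(\Omega)}\bigr)_{k=1}^{N_d}.$$ *)

theory Defs
  imports "HOL-Probability.Probability"
begin

section \<open>Sobolev spaces on Euclidean domains\<close>

definition pd :: "'d::finite \<Rightarrow> (real^'d \<Rightarrow> real) \<Rightarrow> real^'d \<Rightarrow> real" where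
  "pd i f = (\<lambda>x. frechet_derivative f (at x) (axis i 1))"

text \<open>\<^term>\<open>foldr pd is\<close> is the iterated classical partial derivative along the index list
  \<^term>\<open>is\<close>; lists play the role of multi-indices throughout.\<close>

definition smooth_fun :: "(real^'d::finite \<Rightarrow> real) \<Rightarrow> bool" where
  "smooth_fun f \<longleftrightarrow> (\<forall>is. foldr pd is f differentiable_on UNIV)"

definition test_functions :: "(real^'d::finite) set \<Rightarrow> (real^'d \<Rightarrow> real) set" where
  "test_functions \<Omega> =
     {\<phi>. smooth_fun \<phi> \<and> (\<exists>K. compact K \<and> K \<subseteq> \<Omega> \<and> (\<forall>x. x \<notin> K \<longrightarrow> \<phi> x = 0))}"

definition L2_fun :: "(real^'d::finite) set \<Rightarrow> (real^'d \<Rightarrow> real) set" where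
  "L2_fun \<Omega> =
     {f \<in> borel_measurable (lebesgue_on \<Omega>). integrable (lebesgue_on \<Omega>) (\<lambda>x. (f x)\<^sup>2)}"

definition is_weak_deriv ::
  "(real^'d::finite) set \<Rightarrow> 'd list \<Rightarrow> (real^'d \<Rightarrow> real) \<Rightarrow> (real^'d \<Rightarrow> real) \<Rightarrow> bool" where
  "is_weak_deriv \<Omega> is f g \<longleftrightarrow> g \<in> L2_fun \<Omega> \<and>
     (\<forall>\<phi>\<in>test_functions \<Omega>.
        (\<integral>x. f x * foldr pd is \<phi> x \<partial>lebesgue_on \<Omega>) =
        (-1) ^ length is * (\<integral>x. g x * \<phi> x \<partial>lebesgue_on \<Omega>))"

text \<open>A representative; weak derivatives are unique only up to null sets.\<close>

definition weak_deriv ::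
  "(real^'d::finite) set \<Rightarrow> 'd list \<Rightarrow> (real^'d \<Rightarrow> real) \<Rightarrow> real^'d \<Rightarrow> real" where
  "weak_deriv \<Omega> is f = (SOME g. is_weak_deriv \<Omega> is f g)"

definition slobodeckij :: "(real^'d::finite) set \<Rightarrow> real \<Rightarrow> (real^'d \<Rightarrow> real) \<Rightarrow> ennreal" where
  "slobodeckij \<Omega> \<theta> f =
     (\<integral>\<^sup>+x. (\<integral>\<^sup>+y. ennreal ((f x - f y)\<^sup>2 / dist x y powr (real CARD('d) + 2 * \<theta>))
        \<partial>lebesgue_on \<Omega>) \<partial>lebesgue_on \<Omega>)"

text \<open>Sobolev--Slobodeckij spaces of real order \<^term>\<open>s \<ge> 0\<close>: square integrable weak derivatives up to
  order \<^term>\<open>\<lfloor>s\<rfloor>\<close>, and, if \<^term>\<open>s\<close> is not an integer, a finite Gagliardo seminorm of order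
  \<^term>\<open>frac s\<close> of the top order derivatives. On Lipschitz domains this is the usual fractional
  Sobolev space, with an equivalent norm.\<close>

definition sobolev_energy :: "(real^'d::finite) set \<Rightarrow> real \<Rightarrow> (real^'d \<Rightarrow> real) \<Rightarrow> ennreal" where
  "sobolev_energy \<Omega> s f =
     (\<Sum>is | length is \<le> nat \<lfloor>s\<rfloor>. \<integral>\<^sup>+x. ennreal ((weak_deriv \<Omega> is f x)\<^sup>2) \<partial>lebesgue_on \<Omega>) +
     (if frac s > 0
      then \<Sum>is | length is = nat \<lfloor>s\<rfloor>. slobodeckij \<Omega> (frac s) (weak_deriv \<Omega> is f)
      else 0)"

definition sobolev_fun :: "(real^'d::finite) set \<Rightarrow> real \<Rightarrow> (real^'d \<Rightarrow> real) set" where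
  "sobolev_fun \<Omega> s =
     {f \<in> L2_fun \<Omega>. (\<forall>is. length is \<le> nat \<lfloor>s\<rfloor> \<longrightarrow> (\<exists>g. is_weak_deriv \<Omega> is f g)) \<and>
        sobolev_energy \<Omega> s f < \<infinity>}"

definition sobolev_norm :: "(real^'d::finite) set \<Rightarrow> real \<Rightarrow> (real^'d \<Rightarrow> real) \<Rightarrow> real" where
  "sobolev_norm \<Omega> s f = sqrt (enn2real (sobolev_energy \<Omega> s f))"

definition ae_class ::
  "(real^'d::finite) set \<Rightarrow> (real^'d \<Rightarrow> real) \<Rightarrow> (real^'d \<Rightarrow> real) set" where
  "ae_class \<Omega> f = {g \<in> borel_measurable (lebesgue_on \<Omega>). AE x in lebesgue_on \<Omega>. g x = f x}"

text \<open>The Sobolev space of almost-everywhere classes, with its norm topology; the generating sets are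
  the open norm balls, so the underlying set is the set of all classes of Sobolev functions.\<close>

definition sobolev_space ::
  "(real^'d::finite) set \<Rightarrow> real \<Rightarrow> (real^'d \<Rightarrow> real) set topology" where
  "sobolev_space \<Omega> s = topology_generated_by
     {ae_class \<Omega> ` {g \<in> sobolev_fun \<Omega> s. sobolev_norm \<Omega> s (\<lambda>x. g x - f x) < r} | f r.
        f \<in> sobolev_fun \<Omega> s \<and> 0 < r}"

abbreviation H1 :: "(real^'d::finite) set \<Rightarrow> (real^'d \<Rightarrow> real) set" where
  "H1 \<Omega> \<equiv> sobolev_fun \<Omega> 1"

abbreviation H1_norm :: "(real^'d::finite) set \<Rightarrow> (real^'d \<Rightarrow> real) \<Rightarrow> real" where
  "H1_norm \<Omega> \<equiv> sobolev_norm \<Omega> 1"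

definition H1_0 :: "(real^'d::finite) set \<Rightarrow> (real^'d \<Rightarrow> real) set" where
  "H1_0 \<Omega> = {u \<in> H1 \<Omega>. \<exists>\<phi>. (\<forall>n. \<phi> n \<in> test_functions \<Omega>) \<and>
     (\<lambda>n. H1_norm \<Omega> (\<lambda>x. \<phi> n x - u x)) \<longlonglongrightarrow> 0}"

definition grad_prod ::
  "(real^'d::finite) set \<Rightarrow> (real^'d \<Rightarrow> real) \<Rightarrow> (real^'d \<Rightarrow> real) \<Rightarrow> real^'d \<Rightarrow> real" where
  "grad_prod \<Omega> u v x = (\<Sum>i\<in>UNIV. weak_deriv \<Omega> [i] u x * weak_deriv \<Omega> [i] v x)"


section \<open>Lipschitz domains, surface measure and traces\<close>

text \<open>Near every boundary point the domain is, in some orthonormal frame with last vector \<^term>\<open>b\<close>,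
  the strict subgraph of a Lipschitz function of the orthogonal projection onto the complement
  of \<^term>\<open>b\<close>.\<close>

definition lipschitz_domain :: "(real^'d::finite) set \<Rightarrow> bool" where
  "lipschitz_domain \<Omega> \<longleftrightarrow> open \<Omega> \<and> connected \<Omega> \<and> \<Omega> \<noteq> {} \<and> bounded \<Omega> \<and>
     (\<forall>p\<in>frontier \<Omega>. \<exists>r>0. \<exists>b h C. norm b = 1 \<and> C-lipschitz_on UNIV h \<and>
        \<Omega> \<inter> ball p r = {x \<in> ball p r. x \<bullet> b < h (x - (x \<bullet> b) *\<^sub>R b)})"

definition hausdorff_pre :: "nat \<Rightarrow> real \<Rightarrow> 'a::metric_space set \<Rightarrow> ennreal" where
  "hausdorff_pre k \<delta> A =
     (INF C\<in>{C :: nat \<Rightarrow> 'a set. A \<subseteq> (\<Union>i. C i) \<and> (\<forall>i. bounded (C i) \<and> diameter (C i) \<le> \<delta>)}.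
        (\<Sum>i. ennreal (unit_ball_vol (real k) * (diameter (C i) / 2) ^ k)))"

text \<open>The \<^term>\<open>k\<close>-dimensional Hausdorff measure for \<^term>\<open>k \<ge> 1\<close>, normalised so that it is Lebesgue
  measure on \<^term>\<open>k\<close>-dimensional planes.\<close>

definition hausdorff_measure :: "nat \<Rightarrow> 'a::metric_space measure" where
  "hausdorff_measure k =
     measure_of UNIV (sets borel) (\<lambda>A. SUP \<delta>\<in>{0<..}. hausdorff_pre k \<delta> A)"

abbreviation surface_measure :: "(real^'d::finite) measure" where
  "surface_measure \<equiv> hausdorff_measure (CARD('d) - 1)"

text \<open>The boundary trace of an \<open>H\<^sup>1\<close> function, as the continuous extension of the restriction
  map from functions that are smooth up to the boundary.\<close>

definition is_trace ::
  "(real^'d::finite) set \<Rightarrow> (real^'d \<Rightarrow> real) \<Rightarrow> (real^'d \<Rightarrow> real) \<Rightarrow> bool" where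
  "is_trace \<Omega> u t \<longleftrightarrow>
     set_borel_measurable surface_measure (frontier \<Omega>) t \<and>
     set_integrable surface_measure (frontier \<Omega>) (\<lambda>x. (t x)\<^sup>2) \<and>
     (\<exists>\<phi>. (\<forall>n. smooth_fun (\<phi> n)) \<and>
        (\<lambda>n. H1_norm \<Omega> (\<lambda>x. \<phi> n x - u x)) \<longlonglongrightarrow> 0 \<and>
        (\<lambda>n. LINT x:frontier \<Omega>|surface_measure. (\<phi> n x - t x)\<^sup>2) \<longlonglongrightarrow> 0)"

definition bdry_trace :: "(real^'d::finite) set \<Rightarrow> (real^'d \<Rightarrow> real) \<Rightarrow> real^'d \<Rightarrow> real" where
  "bdry_trace \<Omega> u = (SOME t. is_trace \<Omega> u t)"

text \<open>\<open>H\<^bsup>1/2\<^esup>\<close> of the boundary, as the trace space of \<open>H\<^sup>1\<close>.\<close>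

definition H_half :: "(real^'d::finite) set \<Rightarrow> (real^'d \<Rightarrow> real) set" where
  "H_half \<Omega> = {g. \<exists>u\<in>H1 \<Omega>. is_trace \<Omega> u g}"


section \<open>Electrical impedance tomography\<close>

text \<open>The variational form of the complete electrode model with electrodes \<^term>\<open>e\<close>, contact
  impedances \<^term>\<open>z\<close>, conductivity \<^term>\<open>\<sigma>\<close> and applied currents \<^term>\<open>J\<close>: test the equation with
  \<^term>\<open>v\<close>, replace the normal current on each electrode by
  \<open>(U\<^sub>l - u) / z\<^sub>l\<close>, and test the current conditions with \<^term>\<open>V\<close>.\<close>

definition cem_weak_solution ::
  "(real^'d::finite) set \<Rightarrow> ('l::finite \<Rightarrow> (real^'d) set) \<Rightarrow> ('l \<Rightarrow> real) \<Rightarrow> (real^'d \<Rightarrow> real) \<Rightarrow>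
   real^'l \<Rightarrow> (real^'d \<Rightarrow> real) \<Rightarrow> real^'l \<Rightarrow> bool" where
  "cem_weak_solution \<Omega> e z \<sigma> J u U \<longleftrightarrow> u \<in> H1 \<Omega> \<and>
     (\<forall>v\<in>H1 \<Omega>. \<forall>V :: real^'l.
        (\<integral>x. \<sigma> x * grad_prod \<Omega> u v x \<partial>lebesgue_on \<Omega>) +
        (\<Sum>l\<in>UNIV. (1 / z l) *
           (LINT x:e l|surface_measure. (bdry_trace \<Omega> u x - U $ l) * (bdry_trace \<Omega> v x - V $ l)))
        = (\<Sum>l\<in>UNIV. J $ l * V $ l))"

text \<open>The resistivity operator, taking zero-mean currents to grounded electrode voltages.\<close>

definition resistivity ::
  "(real^'d::finite) set \<Rightarrow> ('l::finite \<Rightarrow> (real^'d) set) \<Rightarrow> ('l \<Rightarrow> real) \<Rightarrow> (real^'d \<Rightarrow> real) \<Rightarrow>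
   real^'l \<Rightarrow> real^'l" where
  "resistivity \<Omega> e z \<sigma> J =
     (THE U. (\<Sum>l\<in>UNIV. U $ l) = 0 \<and> (\<exists>u. cem_weak_solution \<Omega> e z \<sigma> J u U))"

definition voltage_matrix ::
  "(real^'d::finite) set \<Rightarrow> ('l::finite \<Rightarrow> (real^'d) set) \<Rightarrow> ('l \<Rightarrow> real) \<Rightarrow> ('l \<Rightarrow> real^'l) \<Rightarrow>
   (real^'d \<Rightarrow> real) \<Rightarrow> real^'l^'l" where
  "voltage_matrix \<Omega> e z I \<sigma> = (\<chi> l j. resistivity \<Omega> e z \<sigma> (I j) $ l)"

definition level_set_map ::
  "(real^'d::finite) set \<Rightarrow> nat \<Rightarrow> (nat \<Rightarrow> real) \<Rightarrow> (nat \<Rightarrow> ereal) \<Rightarrow> (real^'d \<Rightarrow> real) \<Rightarrow>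
   real^'d \<Rightarrow> real" where
  "level_set_map \<Omega> M \<sigma> c f x =
     (\<Sum>i=1..M. \<sigma> i * indicator {x \<in> \<Omega>. c (i - 1) \<le> ereal (f x) \<and> ereal (f x) < c i} x)"

text \<open>The choice of a representative of the class \<^term>\<open>w\<close> changes the conductivity only on a null set,
  hence does not affect the weak formulation.\<close>

definition eit_map ::
  "(real^'d::finite) set \<Rightarrow> ('l::finite \<Rightarrow> (real^'d) set) \<Rightarrow> ('l \<Rightarrow> real) \<Rightarrow> ('l \<Rightarrow> real^'l) \<Rightarrow>
   nat \<Rightarrow> (nat \<Rightarrow> real) \<Rightarrow> (nat \<Rightarrow> ereal) \<Rightarrow> (real^'d \<Rightarrow> real) set \<Rightarrow> real^'l^'l" where
  "eit_map \<Omega> e z I M \<sigma> c w =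
     voltage_matrix \<Omega> e z I (level_set_map \<Omega> M \<sigma> c (SOME f. f \<in> w))"

definition eit_setting ::
  "(real^'d::finite) set \<Rightarrow> ('l::finite \<Rightarrow> (real^'d) set) \<Rightarrow> ('l \<Rightarrow> real) \<Rightarrow> ('l \<Rightarrow> real^'l) \<Rightarrow>
   nat \<Rightarrow> (nat \<Rightarrow> real) \<Rightarrow> (nat \<Rightarrow> ereal) \<Rightarrow> real \<Rightarrow> bool" where
  "eit_setting \<Omega> e z I M \<sigma> c s \<longleftrightarrow>
     CARD('d) \<ge> 2 \<and> lipschitz_domain \<Omega> \<and>
     (\<forall>l. e l \<subseteq> frontier \<Omega> \<and> e l \<in> sets borel \<and> emeasure surface_measure (e l) > 0) \<and>
     (\<forall>l k. l \<noteq> k \<longrightarrow> e l \<inter> e k = {}) \<and>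
     (\<forall>l. z l > 0) \<and>
     (\<forall>j. (\<Sum>l\<in>UNIV. I j $ l) = 0) \<and>
     (\<forall>i\<in>{1..M}. \<sigma> i > 0) \<and>
     c 0 = -\<infinity> \<and> c M = \<infinity> \<and> (\<forall>i<M. c i < c (Suc i)) \<and>
     s > 1"


section \<open>Quantitative photoacoustic tomography\<close>

definition L2_bounded :: "(real^'d::finite) set \<Rightarrow> real \<Rightarrow> (real^'d \<Rightarrow> real) set" where
  "L2_bounded \<Omega> \<Lambda> =
     {f \<in> L2_fun \<Omega>. AE x in lebesgue_on \<Omega>. inverse \<Lambda> \<le> f x \<and> f x \<le> \<Lambda>}"

definition qpat_weak_solution ::
  "(real^2) set \<Rightarrow> (real^2 \<Rightarrow> real) \<Rightarrow> (real^2 \<Rightarrow> real) \<Rightarrow> (real^2 \<Rightarrow> real) \<Rightarrow> (real^2 \<Rightarrow> real) \<Rightarrow> bool"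
  where
  "qpat_weak_solution \<Omega> \<rho> g \<gamma> u \<longleftrightarrow> u \<in> H1 \<Omega> \<and> is_trace \<Omega> u g \<and>
     (\<forall>v\<in>H1_0 \<Omega>.
        (\<integral>x. \<rho> x * grad_prod \<Omega> u v x + \<gamma> x * u x * v x \<partial>lebesgue_on \<Omega>) = 0)"

definition absorbed_energy ::
  "(real^2) set \<Rightarrow> (real^2 \<Rightarrow> real) \<Rightarrow> (real^2 \<Rightarrow> real) \<Rightarrow> (real^2 \<Rightarrow> real) \<Rightarrow> real^2 \<Rightarrow> real" where
  "absorbed_energy \<Omega> \<rho> g \<gamma> = (\<lambda>x. \<gamma> x * (SOME u. qpat_weak_solution \<Omega> \<rho> g \<gamma> u) x)"

definition dirichlet_eigenfunction :: "(real^'d::finite) set \<Rightarrow> (real^'d \<Rightarrow> real) \<Rightarrow> bool" where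
  "dirichlet_eigenfunction \<Omega> f \<longleftrightarrow> f \<in> H1_0 \<Omega> \<and>
     \<not> (AE x in lebesgue_on \<Omega>. f x = 0) \<and>
     (\<exists>ev. \<forall>v\<in>H1_0 \<Omega>.
        (\<integral>x. grad_prod \<Omega> f v x \<partial>lebesgue_on \<Omega>) = ev * (\<integral>x. f x * v x \<partial>lebesgue_on \<Omega>))"

text \<open>Only the members \<^term>\<open>b k\<close> with \<^term>\<open>k \<ge> 1\<close> matter.\<close>

definition L2_orthonormal_basis ::
  "(real^'d::finite) set \<Rightarrow> (nat \<Rightarrow> real^'d \<Rightarrow> real) \<Rightarrow> bool" where
  "L2_orthonormal_basis \<Omega> b \<longleftrightarrow>
     (\<forall>k\<ge>1. b k \<in> L2_fun \<Omega>) \<and>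
     (\<forall>j\<ge>1. \<forall>k\<ge>1. (\<integral>x. b j x * b k x \<partial>lebesgue_on \<Omega>) = (if j = k then 1 else 0)) \<and>
     (\<forall>f\<in>L2_fun \<Omega>.
        (\<lambda>n. \<integral>x. (f x - (\<Sum>k=1..n. (\<integral>y. f y * b k y \<partial>lebesgue_on \<Omega>) * b k x))\<^sup>2
           \<partial>lebesgue_on \<Omega>) \<longlonglongrightarrow> 0)"

definition fourier_coeff :: "(real \<Rightarrow> real) \<Rightarrow> int \<Rightarrow> complex" where
  "fourier_coeff \<psi> k =
     integral {0..2 * pi} (\<lambda>t. complex_of_real (\<psi> t) * cis (- (of_int k * t))) / (2 * pi)"

text \<open>The Sobolev space of order \<^term>\<open>\<beta> > 1/2\<close> on the circle, through Fourier coefficients. For such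
  orders every class has exactly one continuous representative, and the elements are these
  representatives, as \<open>2\<pi>\<close>-periodic functions on the line.\<close>

definition torus_sobolev_fun :: "real \<Rightarrow> (real \<Rightarrow> real) set" where
  "torus_sobolev_fun \<beta> =
     {\<psi>. continuous_on UNIV \<psi> \<and> (\<forall>t. \<psi> (t + 2 * pi) = \<psi> t) \<and>
        (\<lambda>k::int. (1 + (of_int k)\<^sup>2) powr \<beta> * (cmod (fourier_coeff \<psi> k))\<^sup>2) summable_on UNIV}"

definition torus_sobolev_norm :: "real \<Rightarrow> (real \<Rightarrow> real) \<Rightarrow> real" where
  "torus_sobolev_norm \<beta> \<psi> =
     sqrt (\<Sum>\<^sub>\<infinity>k::int. (1 + (of_int k)\<^sup>2) powr \<beta> * (cmod (fourier_coeff \<psi> k))\<^sup>2)"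

definition torus_sobolev_space :: "real \<Rightarrow> (real \<Rightarrow> real) topology" where
  "torus_sobolev_space \<beta> = topology_generated_by
     {{\<eta> \<in> torus_sobolev_fun \<beta>. torus_sobolev_norm \<beta> (\<lambda>t. \<eta> t - \<psi> t) < r} | \<psi> r.
        \<psi> \<in> torus_sobolev_fun \<beta> \<and> 0 < r}"

definition star_space :: "nat \<Rightarrow> real \<Rightarrow> (nat \<Rightarrow> real \<Rightarrow> real) topology" where
  "star_space N \<beta> = product_topology (\<lambda>_. torus_sobolev_space \<beta>) {1..N}"

definition star_shape :: "real^2 \<Rightarrow> (real \<Rightarrow> real) \<Rightarrow> (real^2) set" where
  "star_shape p \<psi> =
     {p + (s * exp (\<psi> t)) *\<^sub>R vector [cos t, sin t] | s t. 0 \<le> s \<and> s \<le> 1 \<and> 0 \<le> t \<and> t \<le> 2 * pi}"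

definition star_region ::
  "(real^2) set \<Rightarrow> nat \<Rightarrow> (nat \<Rightarrow> real^2) \<Rightarrow> (nat \<Rightarrow> real \<Rightarrow> real) \<Rightarrow> nat \<Rightarrow> (real^2) set" where
  "star_region \<Omega> N p w i =
     (if i \<le> N then \<Omega> \<inter> star_shape (p i) (w i)
      else \<Omega> - (\<Union>j\<in>{1..N}. \<Omega> \<inter> star_shape (p j) (w j)))"

definition star_map ::
  "(real^2) set \<Rightarrow> nat \<Rightarrow> (nat \<Rightarrow> real^2) \<Rightarrow> (nat \<Rightarrow> real) \<Rightarrow> (nat \<Rightarrow> real \<Rightarrow> real) \<Rightarrow> real^2 \<Rightarrow> real"
  where
  "star_map \<Omega> N p \<kappa> w x = (\<Sum>i=1..N + 1. \<kappa> i * indicator (star_region \<Omega> N p w i) x)"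

text \<open>The data space is \<^typ>\<open>real^'m\<close>; \<^term>\<open>idx\<close> enumerates its coordinates as \<open>1, \<dots>, CARD('m)\<close>.\<close>

definition qpat_map ::
  "(real^2) set \<Rightarrow> (real^2 \<Rightarrow> real) \<Rightarrow> (real^2 \<Rightarrow> real) \<Rightarrow> nat \<Rightarrow> (nat \<Rightarrow> real^2) \<Rightarrow> (nat \<Rightarrow> real) \<Rightarrow>
   (nat \<Rightarrow> real^2 \<Rightarrow> real) \<Rightarrow> ('m::finite \<Rightarrow> nat) \<Rightarrow> (nat \<Rightarrow> real \<Rightarrow> real) \<Rightarrow> real^'m" where
  "qpat_map \<Omega> \<rho> g N p \<kappa> b idx w =
     (\<chi> j. \<integral>x. absorbed_energy \<Omega> \<rho> g (star_map \<Omega> N p \<kappa> w) x * b (idx j) x \<partial>lebesgue_on \<Omega>)"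

definition qpat_setting ::
  "(real^2) set \<Rightarrow> real \<Rightarrow> (real^2 \<Rightarrow> real) \<Rightarrow> (real^2 \<Rightarrow> real) \<Rightarrow> nat \<Rightarrow> (nat \<Rightarrow> real^2) \<Rightarrow>
   (nat \<Rightarrow> real) \<Rightarrow> real \<Rightarrow> (nat \<Rightarrow> real^2 \<Rightarrow> real) \<Rightarrow> ('m::finite \<Rightarrow> nat) \<Rightarrow> real \<Rightarrow> bool" where
  "qpat_setting \<Omega> \<Lambda>\<^sub>\<rho> \<rho> g N p \<kappa> \<Lambda> b idx \<beta> \<longleftrightarrow>
     lipschitz_domain \<Omega> \<and>
     \<Lambda>\<^sub>\<rho> > 0 \<and> \<rho> \<in> L2_bounded \<Omega> \<Lambda>\<^sub>\<rho> \<and> g \<in> H_half \<Omega> \<and>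
     N \<ge> 1 \<and> (\<forall>i\<in>{1..N}. p i \<in> \<Omega>) \<and> (\<forall>i\<in>{1..N + 1}. \<kappa> i > 0) \<and>
     \<beta> > 3 / 2 \<and>
     \<Lambda> > 0 \<and> (\<forall>w\<in>topspace (star_space N \<beta>). star_map \<Omega> N p \<kappa> w \<in> L2_bounded \<Omega> \<Lambda>) \<and>
     L2_orthonormal_basis \<Omega> b \<and> (\<forall>k\<ge>1. dirichlet_eigenfunction \<Omega> (b k)) \<and>
     bij_betw idx UNIV {1..CARD('m)}"


section \<open>Posteriors, Hellinger distance and surrogates\<close>

definition borel_of :: "'a topology \<Rightarrow> 'a measure" where
  "borel_of T = sigma (topspace T) {U. openin T U}"

text \<open>The prior is a Borel measure, but integrals against it are taken with respect to its completion,
  as is usual for \<open>L\<^sup>2\<close> with respect to the prior. For Borel functions nothing changes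
  (\<open>integral_completion\<close>, \<open>integrable_completion\<close>).\<close>

text \<open>\<^term>\<open>\<tau>\<close> is the standard deviation of the centred Gaussian noise entries. The norm of the data space is the
  Euclidean norm on \<^typ>\<open>real^'m\<close> and the Frobenius norm on \<^typ>\<open>real^'l^'l\<close>.\<close>

definition potential :: "real \<Rightarrow> ('x \<Rightarrow> 'y::euclidean_space) \<Rightarrow> 'y \<Rightarrow> 'x \<Rightarrow> real" where
  "potential \<tau> G y w = 1 / (2 * \<tau>\<^sup>2) * (norm (y - G w))\<^sup>2"

definition evidence :: "'x measure \<Rightarrow> real \<Rightarrow> ('x \<Rightarrow> 'y::euclidean_space) \<Rightarrow> 'y \<Rightarrow> real" where
  "evidence \<mu>\<^sub>0 \<tau> G y = (\<integral>w. exp (- potential \<tau> G y w) \<partial>completion \<mu>\<^sub>0)"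

definition posterior :: "'x measure \<Rightarrow> real \<Rightarrow> ('x \<Rightarrow> 'y::euclidean_space) \<Rightarrow> 'y \<Rightarrow> 'x measure" where
  "posterior \<mu>\<^sub>0 \<tau> G y =
     density (completion \<mu>\<^sub>0) (\<lambda>w. ennreal (1 / evidence \<mu>\<^sub>0 \<tau> G y * exp (- potential \<tau> G y w)))"

definition hellinger :: "'x measure \<Rightarrow> 'x measure \<Rightarrow> 'x measure \<Rightarrow> real" where
  "hellinger \<mu>\<^sub>0 P Q =
     sqrt (1 / 2 * (\<integral>w. (sqrt (enn2real (RN_deriv (completion \<mu>\<^sub>0) P w)) -
                          sqrt (enn2real (RN_deriv (completion \<mu>\<^sub>0) Q w)))\<^sup>2 \<partial>completion \<mu>\<^sub>0))"

lemma evidence_nonneg: "evidence \<mu>\<^sub>0 \<tau> G y \<ge> 0"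
  unfolding evidence_def by (rule integral_nonneg_AE) simp

lemma hellinger_posterior:
  fixes G G' :: "'x \<Rightarrow> 'y::euclidean_space"
  assumes "prob_space \<mu>\<^sub>0"
    and G: "G \<in> borel_measurable (completion \<mu>\<^sub>0)" and G': "G' \<in> borel_measurable (completion \<mu>\<^sub>0)"
  shows "(hellinger \<mu>\<^sub>0 (posterior \<mu>\<^sub>0 \<tau> G y) (posterior \<mu>\<^sub>0 \<tau> G' y))\<^sup>2 =
    1 / 2 * (\<integral>w. (sqrt (exp (- potential \<tau> G y w) / evidence \<mu>\<^sub>0 \<tau> G y) -
                  sqrt (exp (- potential \<tau> G' y w) / evidence \<mu>\<^sub>0 \<tau> G' y))\<^sup>2 \<partial>completion \<mu>\<^sub>0)"
proof -
  interpret prob_space \<mu>\<^sub>0 by fact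
  interpret c: prob_space "completion \<mu>\<^sub>0" by (rule prob_space_completion)
  have m: "potential \<tau> F y \<in> borel_measurable (completion \<mu>\<^sub>0)"
    if "F \<in> borel_measurable (completion \<mu>\<^sub>0)" for F :: "'x \<Rightarrow> 'y"
    using that unfolding potential_def by measurable
  have rn: "AE w in completion \<mu>\<^sub>0.
      enn2real (RN_deriv (completion \<mu>\<^sub>0) (posterior \<mu>\<^sub>0 \<tau> F y) w) =
      exp (- potential \<tau> F y w) / evidence \<mu>\<^sub>0 \<tau> F y"
    if F: "F \<in> borel_measurable (completion \<mu>\<^sub>0)" for F :: "'x \<Rightarrow> 'y"
  proof -
    have "AE w in completion \<mu>\<^sub>0.
        ennreal (1 / evidence \<mu>\<^sub>0 \<tau> F y * exp (- potential \<tau> F y w)) =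
        RN_deriv (completion \<mu>\<^sub>0) (posterior \<mu>\<^sub>0 \<tau> F y) w"
      using m[OF F] by (intro c.RN_deriv_unique) (auto simp: posterior_def)
    then show ?thesis
    proof eventually_elim
      case (elim w)
      show ?case
        unfolding elim[symmetric] by (simp add: evidence_nonneg)
    qed
  qed
  have "(\<integral>w. (sqrt (enn2real (RN_deriv (completion \<mu>\<^sub>0) (posterior \<mu>\<^sub>0 \<tau> G y) w)) -
              sqrt (enn2real (RN_deriv (completion \<mu>\<^sub>0) (posterior \<mu>\<^sub>0 \<tau> G' y) w)))\<^sup>2 \<partial>completion \<mu>\<^sub>0) =
        (\<integral>w. (sqrt (exp (- potential \<tau> G y w) / evidence \<mu>\<^sub>0 \<tau> G y) -
              sqrt (exp (- potential \<tau> G' y w) / evidence \<mu>\<^sub>0 \<tau> G' y))\<^sup>2 \<partial>completion \<mu>\<^sub>0)"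
    using rn[OF G] rn[OF G'] m[OF G] m[OF G']
    by (intro integral_cong_AE) auto
  then show ?thesis
    by (simp add: hellinger_def)
qed

text \<open>\<^term>\<open>A \<circ> E\<close> is an encoder--approximator surrogate with latent space
  \<^term>\<open>Euclidean_space P\<close>. Integrability is what makes the \<open>L\<^sup>2\<close> distance meaningful:
  the Bochner integral of a non-integrable function is zero.\<close>

definition is_surrogate ::
  "'x topology \<Rightarrow> 'x measure \<Rightarrow> ('x \<Rightarrow> 'y::euclidean_space) \<Rightarrow> real \<Rightarrow> nat \<Rightarrow>
   ('x \<Rightarrow> nat \<Rightarrow> real) \<Rightarrow> ((nat \<Rightarrow> real) \<Rightarrow> 'y) \<Rightarrow> bool" where
  "is_surrogate X \<mu>\<^sub>0 G \<epsilon> P E A \<longleftrightarrow>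
     continuous_map X (Euclidean_space P) E \<and>
     continuous_map (Euclidean_space P) euclidean A \<and>
     integrable (completion \<mu>\<^sub>0) (\<lambda>w. (norm (G w - (A \<circ> E) w))\<^sup>2) \<and>
     sqrt (\<integral>w. (norm (G w - (A \<circ> E) w))\<^sup>2 \<partial>completion \<mu>\<^sub>0) \<le> \<epsilon>"

end

(* The square root of a Gaussian density is a Gaussian profile of twice the variance, hence Lipschitz
   in the mean, so it changes by at most \<epsilon> / (2 \<tau>) in the L2 norm of the prior when the forward map
   changes by \<epsilon>. Expanding the square bounds the Hellinger distance by this L2 distance and the two
   evidences, and the surrogate evidence cannot degenerate because it is close to the true one.
   The forward map is measurable modulo null sets because a sequence of continuous surrogates
   converges to it almost everywhere. *)

theory Submission
  imports Defs
begin

section \<open>Lipschitz dependence of the root likelihood on the forward map\<close>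

text \<open>Mean value theorem: the derivative \<open>- 2 * x * exp (- (x\<^sup>2))\<close> is at
  most 1 in absolute value, since 2|x| \<le> 1 + x^2 \<le> exp (x^2). The optimal constant sqrt (2 /
  e) is slightly smaller; 1 keeps the later bounds simple.\<close>

lemma gaussian_lipschitz: "\<bar>exp (- (u\<^sup>2)) - exp (- (v\<^sup>2))\<bar> \<le> \<bar>u - v\<bar>" for u v :: real
proof -
  have "norm (exp (- (u\<^sup>2)) - exp (- (v\<^sup>2))) \<le> 1 * norm (u - v)"
  proof (rule field_differentiable_bound[where S = UNIV and f' = "\<lambda>x. - 2 * x * exp (- (x\<^sup>2))"])
    fix x :: real
    show "((\<lambda>x. exp (- (x\<^sup>2))) has_field_derivative - 2 * x * exp (- (x\<^sup>2))) (at x within UNIV)"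
      by (auto intro!: derivative_eq_intros)
    have "2 * \<bar>x\<bar> \<le> 1 + x\<^sup>2"
      using zero_le_power2[of "\<bar>x\<bar> - 1"] by (simp add: power2_diff)
    also have "\<dots> \<le> exp (x\<^sup>2)"
      by (rule exp_ge_add_one_self)
    finally show "norm (- 2 * x * exp (- (x\<^sup>2))) \<le> 1"
      by (simp add: abs_mult exp_minus field_simps)
  qed auto
  then show ?thesis by simp
qed

lemma potential_nonneg: "potential \<tau> G y w \<ge> 0"
  by (simp add: potential_def)

text \<open>Each root likelihood is the profile exp (- u^2) at the scaled misfit norm, and the
  reverse triangle inequality then eliminates \<open>y\<close>. The bound is pointwise in
  \<open>w\<close> and uniform in the data.\<close>

lemma sqrt_likelihood_lipschitz:
  fixes G G' :: "'x \<Rightarrow> 'y::euclidean_space"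
  assumes "\<tau> > 0"
  shows "(sqrt (exp (- potential \<tau> G y w)) - sqrt (exp (- potential \<tau> G' y w)))\<^sup>2
    \<le> (norm (G w - G' w))\<^sup>2 / (2 * \<tau>)\<^sup>2"
proof -
  \<comment> \<open>The root halves the exponent: 1 / (2 * \<tau>^2) becomes 1 / (4 * \<tau>^2),
    which is the source of the scale 2 * \<tau> in all later estimates.\<close>
  have sq: "sqrt (exp (- potential \<tau> F y w)) = exp (- ((norm (y - F w) / (2 * \<tau>))\<^sup>2))"
    for F :: "'x \<Rightarrow> 'y"
    using assms by (intro real_sqrt_unique)
      (simp_all add: potential_def power_divide power_mult_distrib field_simps flip: exp_double)
  have "\<bar>sqrt (exp (- potential \<tau> G y w)) - sqrt (exp (- potential \<tau> G' y w))\<bar>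
      \<le> \<bar>norm (y - G w) / (2 * \<tau>) - norm (y - G' w) / (2 * \<tau>)\<bar>"
    unfolding sq by (rule gaussian_lipschitz)
  also have "\<dots> = \<bar>norm (y - G w) - norm (y - G' w)\<bar> / (2 * \<tau>)"
    using assms by (simp flip: diff_divide_distrib)
  also have "\<dots> \<le> norm (G w - G' w) / (2 * \<tau>)"
    using assms norm_triangle_ineq3[of "y - G w" "y - G' w"]
    by (intro divide_right_mono) (auto simp: norm_minus_commute)
  finally show ?thesis
    unfolding power_divide[symmetric] using assms by (simp flip: abs_le_square_iff)
qed

section \<open>Measurability of the forward map modulo null sets\<close>

text \<open>The preimages of a set under \<open>f\<close> and \<open>g\<close> differ only inside a
  null set, all of whose subsets are measurable in the completion.\<close>

lemma measurable_completion_AE_cong: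
  assumes "f \<in> measurable (completion M) N" "AE x in completion M. f x = g x"
    and "g \<in> space M \<rightarrow> space N"
  shows "g \<in> measurable (completion M) N"
proof (rule measurableI)
  fix A assume A: "A \<in> sets N"
  have "f -` A \<inter> space (completion M) \<in> sets (completion M)"
    using assms(1) A by (rule measurable_sets)
  then show "g -` A \<inter> space (completion M) \<in> sets (completion M)"
    by (rule completion.in_sets_AE[rotated]) (use assms(2) in auto)
qed (use assms(3) in auto)

lemma borel_measurable_completion_AE_LIMSEQ:
  fixes F :: "nat \<Rightarrow> 'a \<Rightarrow> 'b::metric_space"
  assumes F: "\<And>n. F n \<in> borel_measurable (completion M)"
    and lim: "AE x in completion M. (\<lambda>n. F n x) \<longlonglongrightarrow> G x"
  shows "G \<in> borel_measurable (completion M)"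
proof -
  define S where "S = {x \<in> space (completion M). \<not> (\<lambda>n. F n x) \<longlonglongrightarrow> G x}"
  \<comment> \<open>Measurability of \<open>G\<close> is the goal, so \<open>S\<close> cannot be
    shown measurable directly. It lies in a null set by \<open>lim\<close>, and completeness makes
    it measurable.\<close>
  have S: "S \<in> null_sets (completion M)"
    using lim unfolding S_def by (rule completion.AE_iff_null_sets[THEN iffD1])
  \<comment> \<open>Overwriting all functions by one constant on \<open>S\<close> turns almost
    everywhere convergence into convergence at every point.\<close>
  have "(\<lambda>x. if x \<in> S then undefined else G x) \<in> borel_measurable (completion M)"
  proof (rule borel_measurable_LIMSEQ_metric)
    show "(\<lambda>x. if x \<in> S then undefined else F n x) \<in> borel_measurable (completion M)" for n
      using F null_setsD2[OF S] by (intro measurable_If_set measurable_const sets.Int sets.top) auto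
    show "(\<lambda>n. if x \<in> S then undefined else F n x) \<longlonglongrightarrow> (if x \<in> S then undefined else G x)"
      if "x \<in> space (completion M)" for x
      using that by (simp add: S_def)
  qed
  moreover have "AE x in completion M. (if x \<in> S then undefined else G x) = G x"
    using lim by eventually_elim (simp add: S_def)
  ultimately show ?thesis
    by (rule measurable_completion_AE_cong) simp
qed

lemma continuous_map_borel_measurable_completion:
  assumes "continuous_map X euclidean f" "sets M = sets (borel_of X)"
  shows "f \<in> borel_measurable (completion M)"
proof -
  have "f \<in> borel_measurable (borel_of X)"
  proof (rule borel_measurableI)
    fix S :: "'b set" assume "open S"
    then have "openin X {x \<in> topspace X. f x \<in> S}"
      using assms(1) by (auto simp: continuous_map_def)
    moreover have "space (borel_of X) = topspace X"
      by (simp add: borel_of_def space_measure_of_conv)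
    moreover have "sets (borel_of X) = sigma_sets (topspace X) {U. openin X U}"
      unfolding borel_of_def by (rule sets_measure_of) (auto dest: openin_subset)
    ultimately show "f -` S \<inter> space (borel_of X) \<in> sets (borel_of X)"
      by (auto simp: vimage_def Int_def conj_commute intro: sigma_sets.Basic)
  qed
  then show ?thesis
    using measurable_cong_sets[OF assms(2) refl] measurable_completion by blast
qed

lemma is_surrogate_measurable:
  assumes "is_surrogate X \<mu> G \<epsilon> P E A" "sets \<mu> = sets (borel_of X)"
  shows "A \<circ> E \<in> borel_measurable (completion \<mu>)"
proof (rule continuous_map_borel_measurable_completion)
  show "continuous_map X euclidean (A \<circ> E)"
    using assms(1) unfolding is_surrogate_def by (auto intro: continuous_map_compose)
qed (rule assms(2))

lemma is_surrogate_L2_bound: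
  assumes "is_surrogate X \<mu> G \<epsilon> P E A"
  shows "(\<integral>w. (norm (G w - (A \<circ> E) w))\<^sup>2 \<partial>completion \<mu>) \<le> \<epsilon>\<^sup>2"
  using assms unfolding is_surrogate_def by (auto dest: sqrt_le_D)

text \<open>This supplies the measurability needed for the posterior of \<open>G\<close> without any
  analysis of the underlying boundary value problem: having surrogates for every positive tolerance
  already forces it.\<close>

lemma L2_limit_of_surrogates_measurable:
  fixes G :: "'x \<Rightarrow> 'y::euclidean_space"
  assumes sets: "sets \<mu> = sets (borel_of X)"
    and sur: "\<And>\<epsilon>. \<epsilon> > 0 \<Longrightarrow> is_surrogate X \<mu> G \<epsilon> (P \<epsilon>) (E \<epsilon>) (A \<epsilon>)"
  shows "G \<in> borel_measurable (completion \<mu>)"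
proof -
  \<comment> \<open>\<open>Suc n\<close> keeps the tolerance positive at n = 0 as well, so that
    \<open>sur\<close> applies to every index.\<close>
  define F where "F n = A (1 / Suc n) \<circ> E (1 / Suc n)" for n
  have sur': "is_surrogate X \<mu> G (1 / Suc n) (P (1 / Suc n)) (E (1 / Suc n)) (A (1 / Suc n))" for n
    by (rule sur) simp
  have int: "integrable (completion \<mu>) (\<lambda>w. (norm (G w - F n w))\<^sup>2)" for n
    using sur'[of n] by (simp add: is_surrogate_def F_def)
  \<comment> \<open>L2 convergence is read as L1 convergence of the squared distances; this yields
    almost everywhere convergence only along a subsequence, which is enough here.\<close>
  have "(\<lambda>n. \<integral>w. norm ((norm (G w - F n w))\<^sup>2) \<partial>completion \<mu>) \<longlonglongrightarrow> 0"
  proof (rule tendsto_sandwich[where f = "\<lambda>_. 0"])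
    show "(\<lambda>n. (1 / real (Suc n))\<^sup>2) \<longlonglongrightarrow> 0"
      using tendsto_power[OF LIMSEQ_inverse_real_of_nat, of 2] by (simp add: inverse_eq_divide)
    show "\<forall>\<^sub>F n in sequentially.
        (\<integral>w. norm ((norm (G w - F n w))\<^sup>2) \<partial>completion \<mu>) \<le> (1 / real (Suc n))\<^sup>2"
      using is_surrogate_L2_bound[OF sur'] by (intro always_eventually) (simp add: F_def)
  qed (auto intro!: always_eventually)
  then obtain r where r: "strict_mono r"
    "AE w in completion \<mu>. (\<lambda>n. (norm (G w - F (r n) w))\<^sup>2) \<longlonglongrightarrow> 0"
    using tendsto_L1_AE_subseq[of "completion \<mu>" "\<lambda>n w. (norm (G w - F n w))\<^sup>2"] int
    by blast
  show ?thesis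
  proof (rule borel_measurable_completion_AE_LIMSEQ)
    show "F (r n) \<in> borel_measurable (completion \<mu>)" for n
      unfolding F_def by (rule is_surrogate_measurable[OF sur' sets])
    show "AE w in completion \<mu>. (\<lambda>n. F (r n) w) \<longlonglongrightarrow> G w"
      using r(2)
    proof eventually_elim
      case (elim w)
      have "(\<lambda>n. norm (F (r n) w - G w)) \<longlonglongrightarrow> 0"
        using tendsto_real_sqrt[OF elim] by (simp add: norm_minus_commute)
      then show ?case
        by (rule LIM_zero_cancel[OF tendsto_norm_zero_cancel])
    qed
  qed
qed

section \<open>Quantitative bound for the Hellinger distance of the posteriors\<close>

lemma hellinger_nonneg: "hellinger \<mu> P Q \<ge> 0"
  by (simp add: hellinger_def)

(* Expand both squares and use sqrt (A * B) \<le> (A + B) / 2 for A, B the two squared L2 norms. *)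
lemma normalized_L2_dist_le:
  fixes a b :: "'x \<Rightarrow> real"
  assumes a: "integrable M (\<lambda>w. (a w)\<^sup>2)" and b: "integrable M (\<lambda>w. (b w)\<^sup>2)"
    and d: "integrable M (\<lambda>w. (a w - b w)\<^sup>2)"
    and A: "(\<integral>w. (a w)\<^sup>2 \<partial>M) = A" "A > 0" and B: "(\<integral>w. (b w)\<^sup>2 \<partial>M) = B" "B > 0"
  shows "(\<integral>w. (a w / sqrt A - b w / sqrt B)\<^sup>2 \<partial>M) \<le> (\<integral>w. (a w - b w)\<^sup>2 \<partial>M) / sqrt (A * B)"
proof -
  define s t where "s = sqrt A" and "t = sqrt B"
  have st: "s > 0" "t > 0" "s\<^sup>2 = A" "t\<^sup>2 = B" "sqrt (A * B) = s * t"
    using A B by (simp_all add: s_def t_def real_sqrt_mult)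
  \<comment> \<open>The cross term is written through 2ab = a^2 + b^2 - (a - b)^2, so only functions
    with assumed integrability appear.\<close>
  have "(\<integral>w. (a w / s - b w / t)\<^sup>2 \<partial>M) =
      (\<integral>w. (a w)\<^sup>2 / A + (b w)\<^sup>2 / B - ((a w)\<^sup>2 + (b w)\<^sup>2 - (a w - b w)\<^sup>2) / (s * t) \<partial>M)"
    using st(1,2) unfolding st(3,4)[symmetric]
    by (intro Bochner_Integration.integral_cong refl)
      (simp add: power2_eq_square field_simps)
  also have "\<dots> = 2 - (A + B - (\<integral>w. (a w - b w)\<^sup>2 \<partial>M)) / (s * t)"
    using a b d A B by simp
  \<comment> \<open>From A + B = (s - t)^2 + 2st the constant 2 cancels; the remaining square enters
    with a minus sign and is dropped next.\<close>
  also have "\<dots> = (\<integral>w. (a w - b w)\<^sup>2 \<partial>M) / (s * t) - (s - t)\<^sup>2 / (s * t)"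
    using st(1,2) unfolding st(3,4)[symmetric] by (simp add: power2_eq_square field_simps)
  also have "\<dots> \<le> (\<integral>w. (a w - b w)\<^sup>2 \<partial>M) / (s * t)"
    using st(1,2) by simp
  finally show ?thesis
    by (simp add: s_def t_def real_sqrt_mult)
qed

text \<open>The likelihood takes values in (0, 1]: the upper bound gives integrability over a
  probability space, and strict positivity excludes a zero integral, since a function vanishing
  almost everywhere would have to vanish somewhere.\<close>

lemma
  assumes "prob_space \<mu>" and G: "G \<in> borel_measurable (completion \<mu>)"
  shows integrable_likelihood: "integrable (completion \<mu>) (\<lambda>w. exp (- potential \<tau> G y w))"
    and evidence_pos: "evidence \<mu> \<tau> G y > 0"
proof -
  interpret prob_space \<mu> by fact
  interpret c: prob_space "completion \<mu>" by (rule prob_space_completion)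
  have "potential \<tau> G y \<in> borel_measurable (completion \<mu>)"
    using G unfolding potential_def by measurable
  then show int: "integrable (completion \<mu>) (\<lambda>w. exp (- potential \<tau> G y w))"
    by (intro c.integrable_const_bound[where B = 1]) (auto simp: potential_nonneg)
  have "evidence \<mu> \<tau> G y \<noteq> 0"
    unfolding evidence_def using integral_nonneg_eq_0_iff_AE[OF int] c.AE_False by simp
  then show "evidence \<mu> \<tau> G y > 0"
    using evidence_nonneg[of \<mu> \<tau> G y] by linarith
qed

text \<open>The right-hand side contains only the evidence of \<open>G\<close>, so the estimate is
  uniform over all surrogates of accuracy \<epsilon>. The condition \<open>small\<close> serves to
  bound the surrogate evidence from below by a quarter of the true one.\<close>

lemma hellinger_posterior_bound:
  fixes G G' :: "'x \<Rightarrow> 'y::euclidean_space"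
  assumes prob: "prob_space \<mu>" and "\<tau> > 0"
    and G: "G \<in> borel_measurable (completion \<mu>)" and G': "G' \<in> borel_measurable (completion \<mu>)"
    and int: "integrable (completion \<mu>) (\<lambda>w. (norm (G w - G' w))\<^sup>2)"
    and le: "(\<integral>w. (norm (G w - G' w))\<^sup>2 \<partial>completion \<mu>) \<le> \<epsilon>\<^sup>2"
    and small: "\<epsilon>\<^sup>2 / (2 * \<tau>)\<^sup>2 \<le> evidence \<mu> \<tau> G y / 4"
  shows "(hellinger \<mu> (posterior \<mu> \<tau> G y) (posterior \<mu> \<tau> G' y))\<^sup>2 \<le>
      \<epsilon>\<^sup>2 / (2 * \<tau>)\<^sup>2 / evidence \<mu> \<tau> G y"
proof -
  define M where "M = completion \<mu>"
  define a where "a w = sqrt (exp (- potential \<tau> G y w))" for w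
  define b where "b w = sqrt (exp (- potential \<tau> G' y w))" for w
  define A where "A = evidence \<mu> \<tau> G y"
  define B where "B = evidence \<mu> \<tau> G' y"
  define D where "D = (\<integral>w. (a w - b w)\<^sup>2 \<partial>M)"
  have [measurable]: "a \<in> borel_measurable M" "b \<in> borel_measurable M"
    using G G' unfolding a_def b_def potential_def M_def by measurable
  have pos: "A > 0" "B > 0"
    using evidence_pos[OF prob] G G' by (auto simp: A_def B_def)
  have ia: "integrable M (\<lambda>w. (a w)\<^sup>2)" and ib: "integrable M (\<lambda>w. (b w)\<^sup>2)"
    using integrable_likelihood[OF prob] G G' by (auto simp: a_def b_def M_def)
  have eqs: "(\<integral>w. (a w)\<^sup>2 \<partial>M) = A" "(\<integral>w. (b w)\<^sup>2 \<partial>M) = B"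
    by (simp_all add: a_def b_def A_def B_def M_def evidence_def)
  have int': "integrable M (\<lambda>w. (norm (G w - G' w))\<^sup>2 / (2 * \<tau>)\<^sup>2)"
    using int by (simp add: M_def)
  have lip: "(a w - b w)\<^sup>2 \<le> (norm (G w - G' w))\<^sup>2 / (2 * \<tau>)\<^sup>2" for w
    unfolding a_def b_def by (rule sqrt_likelihood_lipschitz[OF \<open>\<tau> > 0\<close>])
  have iab: "integrable M (\<lambda>w. (a w - b w)\<^sup>2)"
    using lip by (intro Bochner_Integration.integrable_bound[OF int']) auto
  have "D \<le> (\<integral>w. (norm (G w - G' w))\<^sup>2 / (2 * \<tau>)\<^sup>2 \<partial>M)"
    unfolding D_def using lip by (intro integral_mono iab int')
  also have "\<dots> \<le> \<epsilon>\<^sup>2 / (2 * \<tau>)\<^sup>2"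
    using le by (simp add: M_def divide_right_mono)
  finally have D: "D \<le> \<epsilon>\<^sup>2 / (2 * \<tau>)\<^sup>2" .
  \<comment> \<open>The integrands differ by (a - 2b)^2. Integrating gives A \<le> 2B + 2D, and D
    \<le> A / 4 turns this into B \<ge> A / 4.\<close>
  have "A \<le> (\<integral>w. 2 * (b w)\<^sup>2 + 2 * (a w - b w)\<^sup>2 \<partial>M)"
    unfolding eqs(1)[symmetric]
  proof (intro integral_mono ia)
    show "integrable M (\<lambda>w. 2 * (b w)\<^sup>2 + 2 * (a w - b w)\<^sup>2)"
      using ib iab by simp
    show "(a w)\<^sup>2 \<le> 2 * (b w)\<^sup>2 + 2 * (a w - b w)\<^sup>2" for w
      using zero_le_power2[of "a w - 2 * b w"] by (simp add: power2_eq_square algebra_simps)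
  qed
  also have "\<dots> = 2 * B + 2 * D"
    using ib iab by (simp add: eqs D_def)
  finally have "A / 4 \<le> B"
    using D small by (simp add: A_def)
  then have "(A / 2)\<^sup>2 \<le> A * B"
    using pos by (simp add: power2_eq_square)
  then have AB: "A / 2 \<le> sqrt (A * B)"
    by (rule real_le_rsqrt)
  have "(hellinger \<mu> (posterior \<mu> \<tau> G y) (posterior \<mu> \<tau> G' y))\<^sup>2 =
      1 / 2 * (\<integral>w. (a w / sqrt A - b w / sqrt B)\<^sup>2 \<partial>M)"
    unfolding hellinger_posterior[OF prob G G'] a_def b_def A_def B_def M_def
    by (simp add: real_sqrt_divide)
  also have "\<dots> \<le> 1 / 2 * (D / sqrt (A * B))"
    using normalized_L2_dist_le[OF ia ib iab eqs(1) pos(1) eqs(2) pos(2)] by (simp add: D_def)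
  \<comment> \<open>The quarter in \<open>small\<close> was chosen so that this lower bound A / 2
    cancels the factor 1 / 2 of the Hellinger distance.\<close>
  also have "\<dots> \<le> 1 / 2 * (D / (A / 2))"
    using AB pos by (intro mult_left_mono divide_left_mono) (auto simp: D_def)
  also have "\<dots> \<le> \<epsilon>\<^sup>2 / (2 * \<tau>)\<^sup>2 / A"
    using divide_right_mono[OF D, of A] pos by simp
  finally show ?thesis
    by (simp add: A_def)
qed

section \<open>Passage to the limit and the two forward maps\<close>

text \<open>Stated for an arbitrary topology \<open>X\<close> and map \<open>G\<close>, so that both
  inverse problems become instances. The argument gives the linear rate \<epsilon> / (2 * \<tau> *
  sqrt Z) for all small \<epsilon>.\<close>

lemma hellinger_surrogate_tendsto_0:
  fixes G :: "'x \<Rightarrow> 'y::euclidean_space"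
  assumes prob: "prob_space \<mu>" and \<tau>: "\<tau> > 0" and sets: "sets \<mu> = sets (borel_of X)"
    and sur: "\<And>\<epsilon>. \<epsilon> > 0 \<Longrightarrow> is_surrogate X \<mu> G \<epsilon> (P \<epsilon>) (E \<epsilon>) (A \<epsilon>)"
  shows "((\<lambda>\<epsilon>. hellinger \<mu> (posterior \<mu> \<tau> G y) (posterior \<mu> \<tau> (A \<epsilon> \<circ> E \<epsilon>) y)) \<longlongrightarrow> 0)
    (at_right 0)"
proof -
  have G: "G \<in> borel_measurable (completion \<mu>)"
    using sets sur by (rule L2_limit_of_surrogates_measurable)
  define Z where "Z = evidence \<mu> \<tau> G y"
  have Z: "Z > 0"
    unfolding Z_def by (rule evidence_pos[OF prob G])
  have lim: "((\<lambda>\<epsilon>. \<epsilon>\<^sup>2 / (2 * \<tau>)\<^sup>2) \<longlongrightarrow> 0) (at_right 0)"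
    using \<tau> by (auto intro!: tendsto_eq_intros)
  \<comment> \<open>\<open>Z\<close> is positive and independent of \<epsilon>, so the smallness
    condition holds for all \<epsilon> close to 0.\<close>
  have small: "\<forall>\<^sub>F \<epsilon> in at_right 0. \<epsilon>\<^sup>2 / (2 * \<tau>)\<^sup>2 < Z / 4"
    using Z by (intro order_tendstoD(2)[OF lim]) simp
  have pos: "\<forall>\<^sub>F \<epsilon> :: real in at_right 0. \<epsilon> > 0"
    by (rule eventually_at_right_less)
  have "((\<lambda>\<epsilon>. (hellinger \<mu> (posterior \<mu> \<tau> G y) (posterior \<mu> \<tau> (A \<epsilon> \<circ> E \<epsilon>) y))\<^sup>2) \<longlongrightarrow> 0)
      (at_right 0)"
  proof (rule tendsto_sandwich[where f = "\<lambda>_. 0"])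
    show "((\<lambda>\<epsilon>. \<epsilon>\<^sup>2 / (2 * \<tau>)\<^sup>2 / Z) \<longlongrightarrow> 0) (at_right 0)"
      using tendsto_divide_zero[OF lim] .
    show "\<forall>\<^sub>F \<epsilon> in at_right 0.
        (hellinger \<mu> (posterior \<mu> \<tau> G y) (posterior \<mu> \<tau> (A \<epsilon> \<circ> E \<epsilon>) y))\<^sup>2
        \<le> \<epsilon>\<^sup>2 / (2 * \<tau>)\<^sup>2 / Z"
      using small pos
    proof eventually_elim
      case (elim \<epsilon>)
      note s = sur[OF elim(2)]
      show ?case
        unfolding Z_def
      proof (rule hellinger_posterior_bound[OF prob \<tau> G is_surrogate_measurable[OF s sets]])
        show "integrable (completion \<mu>) (\<lambda>w. (norm (G w - (A \<epsilon> \<circ> E \<epsilon>) w))\<^sup>2)"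
          using s by (simp add: is_surrogate_def)
        show "(\<integral>w. (norm (G w - (A \<epsilon> \<circ> E \<epsilon>) w))\<^sup>2 \<partial>completion \<mu>) \<le> \<epsilon>\<^sup>2"
          using s by (rule is_surrogate_L2_bound)
      qed (use elim(1) in \<open>simp add: Z_def\<close>)
    qed
  qed auto
  \<comment> \<open>The bound concerns the squared distance; continuity of the root and
    nonnegativity of \<open>hellinger\<close> transfer the limit.\<close>
  from tendsto_real_sqrt[OF this] show ?thesis
    by (simp add: hellinger_nonneg)
qed

text \<open>Both conjuncts are instances of \<open>hellinger_surrogate_tendsto_0\<close>, for
  \<open>sobolev_space\<close> and \<open>star_space\<close> respectively. The filter
  \<open>at_right 0\<close> lets \<epsilon> tend to 0 through positive values, where the surrogates
  are given.\<close>

theorem theorem3: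
  fixes \<Omega> :: "(real^'d::finite) set" and e :: "'l::finite \<Rightarrow> (real^'d) set"
    and z :: "'l \<Rightarrow> real" and I :: "'l \<Rightarrow> real^'l"
    and M :: nat and \<sigma> :: "nat \<Rightarrow> real" and c :: "nat \<Rightarrow> ereal" and s :: real
    and \<mu>\<^sub>E :: "(real^'d \<Rightarrow> real) set measure" and y\<^sub>E :: "real^'l^'l"
    and P\<^sub>E :: "real \<Rightarrow> nat" and E\<^sub>E :: "real \<Rightarrow> (real^'d \<Rightarrow> real) set \<Rightarrow> nat \<Rightarrow> real"
    and A\<^sub>E :: "real \<Rightarrow> (nat \<Rightarrow> real) \<Rightarrow> real^'l^'l"
  fixes D :: "(real^2) set" and \<Lambda>\<^sub>\<rho> :: real and \<rho> g :: "real^2 \<Rightarrow> real"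
    and N :: nat and p :: "nat \<Rightarrow> real^2" and \<kappa> :: "nat \<Rightarrow> real" and \<Lambda> :: real
    and b :: "nat \<Rightarrow> real^2 \<Rightarrow> real" and idx :: "'m::finite \<Rightarrow> nat" and \<beta> :: real
    and \<mu>\<^sub>Q :: "(nat \<Rightarrow> real \<Rightarrow> real) measure" and y\<^sub>Q :: "real^'m"
    and P\<^sub>Q :: "real \<Rightarrow> nat" and E\<^sub>Q :: "real \<Rightarrow> (nat \<Rightarrow> real \<Rightarrow> real) \<Rightarrow> nat \<Rightarrow> real"
    and A\<^sub>Q :: "real \<Rightarrow> (nat \<Rightarrow> real) \<Rightarrow> real^'m"
  fixes \<tau> :: real
  assumes "\<tau> > 0"
  shows
    "(eit_setting \<Omega> e z I M \<sigma> c s \<and>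
      prob_space \<mu>\<^sub>E \<and> sets \<mu>\<^sub>E = sets (borel_of (sobolev_space \<Omega> s)) \<and>
      (\<forall>\<epsilon>>0. is_surrogate (sobolev_space \<Omega> s) \<mu>\<^sub>E (eit_map \<Omega> e z I M \<sigma> c) \<epsilon> (P\<^sub>E \<epsilon>) (E\<^sub>E \<epsilon>) (A\<^sub>E \<epsilon>))
      \<longrightarrow>
      ((\<lambda>\<epsilon>. hellinger \<mu>\<^sub>E (posterior \<mu>\<^sub>E \<tau> (eit_map \<Omega> e z I M \<sigma> c) y\<^sub>E)
                         (posterior \<mu>\<^sub>E \<tau> (A\<^sub>E \<epsilon> \<circ> E\<^sub>E \<epsilon>) y\<^sub>E)) \<longlongrightarrow> 0) (at_right 0))
     \<and>
     (qpat_setting D \<Lambda>\<^sub>\<rho> \<rho> g N p \<kappa> \<Lambda> b idx \<beta> \<and>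
      prob_space \<mu>\<^sub>Q \<and> sets \<mu>\<^sub>Q = sets (borel_of (star_space N \<beta>)) \<and>
      (\<forall>\<epsilon>>0. is_surrogate (star_space N \<beta>) \<mu>\<^sub>Q (qpat_map D \<rho> g N p \<kappa> b idx) \<epsilon> (P\<^sub>Q \<epsilon>) (E\<^sub>Q \<epsilon>) (A\<^sub>Q \<epsilon>))
      \<longrightarrow>
      ((\<lambda>\<epsilon>. hellinger \<mu>\<^sub>Q (posterior \<mu>\<^sub>Q \<tau> (qpat_map D \<rho> g N p \<kappa> b idx) y\<^sub>Q)
                         (posterior \<mu>\<^sub>Q \<tau> (A\<^sub>Q \<epsilon> \<circ> E\<^sub>Q \<epsilon>) y\<^sub>Q)) \<longlongrightarrow> 0) (at_right 0))"
  using assms by (blast intro: hellinger_surrogate_tendsto_0)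

end
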